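(* Let $(B,+,\circ)$ be a finite skew brace and let $p$ be a prime dividing the order of $B$. If $(B,\circ)$ has a normal Sylow $p$-subgroup $P$, then $B$ has a sub-skew brace of order $p$.
   Context: A skew (left) brace is a triple $(B,+,\circ)$ where $(B,+)$ and $(B,\circ)$ are (not necessarily abelian) groups with $a\circ(b+c)=a\circ b-a+a\circ c$ for all $a,b,c\in B$. A sub-skew brace of $B$ is a subset that is a subgroup of both $(B,+)$ and $(B,\circ)$. *)

theory Defs
  imports "HOL-Algebra.Algebra"
begin

text \<open>
  A skew brace is carried by a record of type \<open>ring\<close>, which supplies two operations on one
  carrier: \<open>\<oplus>\<close> is the (not necessarily commutative) addition \<open>+\<close> and \<open>\<otimes>\<close> is the circle
  operation. No ring axioms are assumed. The group \<open>(B, \<circ>)\<close> is \<open>B\<close> itself and \<open>(B, +)\<close>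
  is \<open>add_monoid B\<close>.
\<close>

locale skew_brace =
  fixes B (structure)
  assumes add_group: "group (add_monoid B)"
    and circ_group: "group B"
    and brace_distrib: "\<lbrakk>a \<in> carrier B; b \<in> carrier B; c \<in> carrier B\<rbrakk> \<Longrightarrow>
          a \<otimes> (b \<oplus> c) = ((a \<otimes> b) \<ominus> a) \<oplus> (a \<otimes> c)"

definition sub_skew_brace :: "'a set \<Rightarrow> ('a, 'm) ring_scheme \<Rightarrow> bool" where
  "sub_skew_brace S B \<longleftrightarrow> subgroup S (add_monoid B) \<and> subgroup S B"

text \<open>Intended for finite \<open>G\<close> and prime \<open>p\<close>; \<open>order G\<close> is \<open>0\<close> for infinite \<open>G\<close>.\<close>

definition sylow_subgroup :: "nat \<Rightarrow> 'a set \<Rightarrow> ('a, 'm) monoid_scheme \<Rightarrow> bool" where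
  "sylow_subgroup p P G \<longleftrightarrow> subgroup P G \<and> card P = p ^ multiplicity p (Coset.order G)"

end

theory Submission
  imports Defs
begin

text \<open>
  Write \<open>\<lambda>\<^sub>a(b) = -a + a \<circ> b\<close>. The distributive law makes \<open>\<lambda>\<close> an action of \<open>(B, \<circ>)\<close> on the
  set \<open>B\<close>, and \<open>\<lambda>\<^sub>a(b) = b\<close> means \<open>a \<circ> b = a + b\<close>. Hence a subgroup \<open>S\<close> of \<open>(B, \<circ>)\<close> such that
  \<open>\<lambda>\<^sub>a(b) = b\<close> for all \<open>a, b \<in> S\<close> is a sub-skew brace, and it suffices to find one of order \<open>p\<close>.

  Let \<open>F\<close> be the set of points fixed by \<open>\<lambda>\<^sub>a\<close> for every \<open>a \<in> P\<close>. As \<open>P\<close> is a \<open>p\<close>-group acting on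
  a set whose size is divisible by \<open>p\<close>, all orbits outside \<open>F\<close> have size divisible by \<open>p\<close>, and so
  \<open>p\<close> divides \<open>card F\<close> (lemma \<open>card_fixed_points_mod_prime\<close>). Because \<open>P\<close> is normal, \<open>F\<close> is a
  subgroup of \<open>(B, \<circ>)\<close> (lemma \<open>subgroup_fixed_by_normal\<close>), so by Cauchy's theorem \<open>F\<close> has a
  subgroup \<open>S\<close> of order \<open>p\<close>. Being normal, \<open>P\<close> contains every \<open>p\<close>-element of \<open>(B, \<circ>)\<close>: such an
  element dies in the quotient by \<open>P\<close>, whose order is prime to \<open>p\<close> (lemma
  \<open>mem_normal_if_pow_coprime_index\<close>). Thus \<open>S\<close> lies in both \<open>P\<close> and \<open>F\<close>, and since
  \<open>P\<close> fixes every point of \<open>F\<close>, \<open>S\<close> acts trivially on itself.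
\<close>

section \<open>Group actions and normal subgroups\<close>

lemma group_actionI:
  fixes G (structure)
  assumes "group G"
    and closed: "\<And>g x. \<lbrakk>g \<in> carrier G; x \<in> E\<rbrakk> \<Longrightarrow> f g x \<in> E"
    and one: "\<And>x. x \<in> E \<Longrightarrow> f \<one> x = x"
    and mult: "\<And>g h x. \<lbrakk>g \<in> carrier G; h \<in> carrier G; x \<in> E\<rbrakk> \<Longrightarrow>
      f (g \<otimes> h) x = f g (f h x)"
  shows "group_action G E (\<lambda>g. \<lambda>x\<in>E. f g x)"
proof -
  interpret group G by fact
  have bij: "(\<lambda>x\<in>E. f g x) \<in> Bij E" if g: "g \<in> carrier G" for g
  proof -
    have "bij_betw (f g) E E"
    proof (rule bij_betw_byWitness[where f' = "f (inv g)"])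
      show "\<forall>x\<in>E. f (inv g) (f g x) = x"
        using g mult[of "inv g" g] one by simp
      show "\<forall>x\<in>E. f g (f (inv g) x) = x"
        using g mult[of g "inv g"] one by simp
    qed (use g closed in auto)
    then show ?thesis by (simp add: Bij_def)
  qed
  have "(\<lambda>g. \<lambda>x\<in>E. f g x) \<in> hom G (BijGroup E)"
  proof (rule homI)
    fix g h assume gh: "g \<in> carrier G" "h \<in> carrier G"
    then have "(\<lambda>x\<in>E. f (g \<otimes> h) x) = compose E (\<lambda>x\<in>E. f g x) (\<lambda>x\<in>E. f h x)"
      by (auto simp: compose_def mult closed)
    then show "(\<lambda>x\<in>E. f (g \<otimes> h) x) = (\<lambda>x\<in>E. f g x) \<otimes>\<^bsub>BijGroup E\<^esub> (\<lambda>x\<in>E. f h x)"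
      using gh by (simp add: BijGroup_def bij)
  qed (simp add: BijGroup_def bij)
  then show ?thesis
    by (intro group_action.intro group_hom.intro group_hom_axioms.intro assms(1) group_BijGroup)
qed

text \<open>Every orbit has \<open>p\<close>-power size, and the orbits of size \<open>1\<close> are the fixed points.\<close>

lemma (in group_action) card_fixed_points_mod_prime:
  assumes p: "Factorial_Ring.prime p" and ord: "order G = p ^ k" and fin: "finite E"
  shows "card {x \<in> E. \<forall>g\<in>carrier G. \<phi> g x = x} mod p = card E mod p"
proof -
  define F where "F = {x \<in> E. \<forall>g\<in>carrier G. \<phi> g x = x}"
  have orbit_subset: "orbit G \<phi> x \<subseteq> E" if "x \<in> E" for x
    using that element_image unfolding orbit_def by blast
  have orbit_fixed: "orbit G \<phi> x \<subseteq> {x}" if "x \<in> F" for x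
    using that unfolding orbit_def F_def by auto
  have not_fixed: "orbit G \<phi> x \<subseteq> E - F" if x: "x \<in> E - F" for x
  proof
    fix y assume y: "y \<in> orbit G \<phi> x"
    then have "y \<in> E" using x orbit_subset by blast
    moreover have "x \<in> orbit G \<phi> y"
      using x y \<open>y \<in> E\<close> orbit_sym by blast
    then have "y \<notin> F" using x orbit_fixed by blast
    ultimately show "y \<in> E - F" by blast
  qed
  have union: "\<Union> (orbit G \<phi> ` (E - F)) = E - F"
    using not_fixed orbit_refl by blast
  have "p dvd card (\<Union> (orbit G \<phi> ` (E - F)))"
  proof (rule dvd_partition)
    show "finite (\<Union> (orbit G \<phi> ` (E - F)))" using fin union by simp
    show "\<forall>c\<in>orbit G \<phi> ` (E - F). p dvd card c"
    proof safe
      fix x assume x: "x \<in> E" "x \<notin> F"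
      have "card (orbit G \<phi> x) dvd p ^ k"
        using orbit_stabilizer_theorem[OF x(1)] ord by (metis dvd_triv_left)
      moreover have "card (orbit G \<phi> x) \<noteq> 1"
      proof
        assume "card (orbit G \<phi> x) = 1"
        then have "orbit G \<phi> x = {x}"
          using orbit_refl[OF x(1)] by (metis card_1_singletonE singletonD)
        then have "x \<in> F" using x(1) unfolding F_def orbit_def by blast
        then show False using x(2) by blast
      qed
      ultimately show "p dvd card (orbit G \<phi> x)"
        using p by (metis divides_primepow_nat dvd_power gr0I power_0)
    qed
    show "\<forall>c1\<in>orbit G \<phi> ` (E - F). \<forall>c2\<in>orbit G \<phi> ` (E - F). c1 \<noteq> c2 \<longrightarrow> c1 \<inter> c2 = {}"
      using disjoint_union unfolding orbits_def by blast
  qed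
  then have "p dvd card (E - F)" using union by simp
  moreover have "card E = card F + card (E - F)"
    using fin card_Un_disjoint[of F "E - F"] unfolding F_def
    by (metis (no_types, lifting) Diff_disjoint Diff_partition finite_Diff finite_subset
        mem_Collect_eq subsetI)
  ultimately show ?thesis unfolding F_def by (auto elim!: dvdE)
qed

text \<open>The order of the coset of \<open>a\<close> in the quotient divides both \<open>n\<close> and the index.\<close>

lemma (in normal) mem_normal_if_pow_coprime_index:
  assumes a: "a \<in> carrier G" and n: "a [^] n = \<one>" and "coprime n (card (rcosets H))"
  shows "a \<in> H"
proof -
  interpret Q: group "G Mod H" by (rule factorgroup_is_group)
  have Ha: "H #> a \<in> carrier (G Mod H)" using a by (auto simp: carrier_FactGroup)
  have "(H #> a) [^]\<^bsub>G Mod H\<^esub> n = \<one>\<^bsub>G Mod H\<^esub>"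
    using FactGroup_pow[OF a, of n] n by (simp add: subset)
  then have "Q.ord (H #> a) dvd n" using Ha Q.pow_eq_id by blast
  moreover have "Q.ord (H #> a) dvd card (rcosets H)"
    using Q.ord_dvd_group_order[OF Ha] by (simp add: Coset.order_def FactGroup_def)
  ultimately have "Q.ord (H #> a) = 1"
    using assms(3) by (metis coprime_common_divisor_nat)
  then have "H #> a = H"
    using Ha Q.pow_ord_eq_1[OF Ha] Q.nat_pow_eone[OF Ha] by simp
  then show ?thesis using a coset_join1 is_subgroup by blast
qed

section \<open>The action of the circle group on a skew brace\<close>

context skew_brace
begin

interpretation circ: group B
  by (rule circ_group)

interpretation add: group "add_monoid B"
  rewrites "carrier (add_monoid B) = carrier B"
    and "monoid.mult (add_monoid B) = (\<oplus>)"
    and "one (add_monoid B) = \<zero>"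
    and "m_inv (add_monoid B) = a_inv B"
  by (rule add_group) (auto simp: m_inv_def a_inv_def)

text \<open>The distributive law at \<open>\<one> \<circ> (\<zero> + \<zero>)\<close> reads \<open>\<zero> = -\<one>\<close>.\<close>

lemma one_eq_zero: "\<one> = \<zero>"
proof -
  have "\<zero> = \<ominus> \<one>"
    using brace_distrib[of \<one> \<zero> \<zero>] by (simp add: a_minus_def)
  then show ?thesis
    by (metis add.inv_inv add.inv_one circ.one_closed)
qed

text \<open>
  With \<open>u = -b + b \<circ> c\<close>, the product \<open>a \<circ> b \<circ> c = a \<circ> (b + u)\<close> expands to
  \<open>a \<circ> b - a + a \<circ> u\<close>, which is multiplicativity of \<open>\<lambda>\<close>.
\<close>

lemma lambda_action: "group_action B (carrier B) (\<lambda>a. \<lambda>b\<in>carrier B. \<ominus> a \<oplus> a \<otimes> b)"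
proof (rule group_actionI)
  fix a b c assume abc: "a \<in> carrier B" "b \<in> carrier B" "c \<in> carrier B"
  let ?u = "\<ominus> b \<oplus> b \<otimes> c"
  have "a \<otimes> b \<otimes> c = a \<otimes> (b \<oplus> ?u)"
    using abc by (simp add: circ.m_assoc flip: add.m_assoc)
  also have "\<dots> = a \<otimes> b \<oplus> (\<ominus> a \<oplus> a \<otimes> ?u)"
    using abc brace_distrib[of a b ?u] by (simp add: a_minus_def add.m_assoc)
  finally show "\<ominus> (a \<otimes> b) \<oplus> a \<otimes> b \<otimes> c = \<ominus> a \<oplus> a \<otimes> ?u"
    using abc by (simp flip: add.m_assoc)
qed (auto simp: circ_group one_eq_zero)

lemma lambda_fixed_iff:
  assumes "a \<in> carrier B" "b \<in> carrier B"
  shows "\<ominus> a \<oplus> a \<otimes> b = b \<longleftrightarrow> a \<otimes> b = a \<oplus> b"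
  using assms by (metis add.inv_closed add.inv_solve_left circ.m_closed)

text \<open>
  For \<open>b\<close> in the fixed set and \<open>a \<in> P\<close>, normality lets \<open>a\<close> be moved past \<open>b\<close> at the price of a
  conjugation inside \<open>P\<close>.
\<close>

lemma subgroup_fixed_by_normal:
  assumes "P \<lhd> B"
  shows "subgroup {b \<in> carrier B. \<forall>a\<in>P. a \<otimes> b = a \<oplus> b} B" (is "subgroup ?F B")
proof -
  interpret P: normal P B by fact
  show ?thesis
  proof (rule circ.subgroupI)
    have "\<one> \<in> ?F"
      using P.subset one_eq_zero by auto
    then show "?F \<noteq> {}" by blast
  next
    fix b assume b: "b \<in> ?F"
    have "a \<otimes> inv b = a \<oplus> inv b" if a: "a \<in> P" for a
    proof -
      have aB: "a \<in> carrier B" using a by (rule P.mem_carrier)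
      \<comment> \<open>Left multiplication by \<open>b\<close> turns both sides into the conjugate of \<open>a\<close> by \<open>b\<close>.\<close>
      define a' where "a' = b \<otimes> a \<otimes> inv b"
      have a': "a' \<in> P" "a' \<in> carrier B"
        unfolding a'_def using a b P.inv_op_closed2 P.mem_carrier by auto
      have "b \<otimes> (a \<oplus> inv b) = b \<otimes> a \<ominus> b \<oplus> b \<otimes> inv b"
        using aB b brace_distrib by simp
      also have "\<dots> = a' \<otimes> b \<ominus> b"
        using aB b unfolding a'_def
        by (simp add: circ.m_assoc a_minus_def flip: one_eq_zero)
      also have "\<dots> = a'"
        using a' b by (simp add: a_minus_def add.m_assoc)
      also have "\<dots> = b \<otimes> (a \<otimes> inv b)"
        using aB b unfolding a'_def by (simp add: circ.m_assoc)
      finally show ?thesis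
        using aB b by simp
    qed
    then show "inv b \<in> ?F" using b by simp
  next
    fix b c
    assume b: "b \<in> ?F"
      and c: "c \<in> ?F"
    have "a \<otimes> (b \<otimes> c) = a \<oplus> b \<otimes> c" if a: "a \<in> P" for a
    proof -
      have aB: "a \<in> carrier B" using a by (rule P.mem_carrier)
      define a' where "a' = inv b \<otimes> a \<otimes> b"
      have a': "a' \<in> P" "a' \<in> carrier B"
        unfolding a'_def using a b P.inv_op_closed1 P.mem_carrier by auto
      have ba': "b \<otimes> a' = a \<otimes> b"
        using aB b unfolding a'_def by (simp flip: circ.m_assoc)
      have "a \<otimes> (b \<otimes> c) = b \<otimes> (a' \<otimes> c)"
        using aB a'(2) b c ba' circ.m_assoc[of a b c] circ.m_assoc[of b a' c] by auto
      also have "\<dots> = b \<otimes> (a' \<oplus> c)" using a' c by simp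
      also have "\<dots> = a \<otimes> b \<ominus> b \<oplus> b \<otimes> c"
        using a' b c brace_distrib ba' by simp
      also have "\<dots> = a \<oplus> b \<otimes> c"
        using a aB b c by (simp add: a_minus_def add.m_assoc)
      finally show ?thesis .
    qed
    then show "b \<otimes> c \<in> ?F" using b c by simp
  qed auto
qed

lemma card_fixed_by_p_subgroup:
  assumes "subgroup P B" and "card P = p ^ k"
    and "Factorial_Ring.prime p" and "finite (carrier B)"
  shows "card {b \<in> carrier B. \<forall>a\<in>P. a \<otimes> b = a \<oplus> b} mod p = Coset.order B mod p"
proof -
  interpret P: subgroup P B by fact
  have "group_action (B\<lparr>carrier := P\<rparr>) (carrier B) (\<lambda>a. \<lambda>b\<in>carrier B. \<ominus> a \<oplus> a \<otimes> b)"
    using group_action.induced_action lambda_action assms(1) by blast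
  then interpret act: group_action "B\<lparr>carrier := P\<rparr>" "carrier B"
    "\<lambda>a. \<lambda>b\<in>carrier B. \<ominus> a \<oplus> a \<otimes> b" .
  have "{b \<in> carrier B. \<forall>a\<in>P. a \<otimes> b = a \<oplus> b} =
    {b \<in> carrier B. \<forall>a\<in>carrier (B\<lparr>carrier := P\<rparr>). (\<lambda>b\<in>carrier B. \<ominus> a \<oplus> a \<otimes> b) b = b}"
    using lambda_fixed_iff by auto
  then show ?thesis
    using act.card_fixed_points_mod_prime[of p k] assms by (simp add: Coset.order_def)
qed

text \<open>If \<open>\<circ>\<close> agrees with \<open>+\<close> on a \<open>\<circ>\<close>-subgroup, then so do the two inverses.\<close>

lemma sub_skew_braceI:
  assumes "subgroup S B" and eq: "\<And>a b. \<lbrakk>a \<in> S; b \<in> S\<rbrakk> \<Longrightarrow> a \<otimes> b = a \<oplus> b"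
  shows "sub_skew_brace S B"
proof -
  interpret S: subgroup S B by fact
  have "subgroup S (add_monoid B)"
  proof (rule add.subgroupI)
    fix a assume a: "a \<in> S"
    then have "a \<oplus> inv a = \<zero>"
      using eq[of a "inv a"] one_eq_zero by simp
    then have "\<ominus> a = inv a"
      using a by (metis S.m_inv_closed S.mem_carrier add.inv_equality add.inv_inv)
    then show "\<ominus> a \<in> S" using a by simp
  next
    fix a b assume "a \<in> S" "b \<in> S"
    then show "a \<oplus> b \<in> S" using eq by (metis S.m_closed)
  qed (use S.subset S.subgroup_axioms subgroup.one_closed in blast)+
  then show ?thesis using assms(1) by (simp add: sub_skew_brace_def)
qed

end

section \<open>Sub-skew braces of prime order\<close>

theorem corollary13:
  fixes B :: "('a, 'm) ring_scheme" and p :: nat and P :: "'a set"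
  assumes "skew_brace B"
    and "finite (carrier B)"
    and "Factorial_Ring.prime p"
    and "p dvd Coset.order B"
    and "sylow_subgroup p P B"
    and "P \<lhd> B"
  shows "\<exists>S. sub_skew_brace S B \<and> card S = p"
proof -
  interpret skew_brace B by fact
  interpret circ: group B by (rule circ_group)
  interpret P: normal P B by fact
  let ?k = "multiplicity p (Coset.order B)"
  have card_P: "card P = p ^ ?k" using assms(5) by (simp add: sylow_subgroup_def)
  define F where "F = {b \<in> carrier B. \<forall>a\<in>P. a \<otimes>\<^bsub>B\<^esub> b = a \<oplus>\<^bsub>B\<^esub> b}"
  have F: "subgroup F B" unfolding F_def using assms(6) by (rule subgroup_fixed_by_normal)
  have "p dvd card F"
    using card_fixed_by_p_subgroup[OF P.is_subgroup card_P assms(3,2)] assms(4)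
    unfolding F_def by (simp add: dvd_eq_mod_eq_0)
  then obtain m where "card F = p ^ 1 * m" by (auto elim: dvdE)
  then obtain S where S: "subgroup S (B\<lparr>carrier := F\<rparr>)" "card S = p ^ 1"
    using sylow_thm[of p "B\<lparr>carrier := F\<rparr>" 1 m] assms(2,3) circ.subgroup_imp_group[OF F]
    by (auto simp: Coset.order_def F_def)
  have SB: "subgroup S B" using circ.incl_subgroup[OF F S(1)] .
  interpret SG: group "B\<lparr>carrier := S\<rparr>" using SB by (rule circ.subgroup_imp_group)
  have "card (rcosets\<^bsub>B\<^esub> P) = Coset.order B div p ^ ?k"
    using circ.lagrange[OF P.is_subgroup] card_P assms(3)
    by (metis nonzero_mult_div_cancel_right not_prime_0 power_not_zero)
  moreover have "Coset.order B \<noteq> 0" using assms(2) circ.order_gt_0_iff_finite by simp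
  ultimately have "\<not> p dvd card (rcosets\<^bsub>B\<^esub> P)"
    using multiplicity_decompose[of "Coset.order B" p] assms(3) not_prime_unit by metis
  then have coprime: "coprime p (card (rcosets\<^bsub>B\<^esub> P))"
    using assms(3) by (simp add: prime_imp_coprime)
  have "S \<subseteq> P"
  proof
    fix x assume x: "x \<in> S"
    have "x [^]\<^bsub>B\<lparr>carrier := S\<rparr>\<^esub> p = \<one>\<^bsub>B\<^esub>"
      using SG.pow_order_eq_1[of x] x S(2) by (simp add: Coset.order_def)
    then have "x [^]\<^bsub>B\<^esub> p = \<one>\<^bsub>B\<^esub>"
      using circ.nat_pow_consistent[of x p S] by simp
    then show "x \<in> P"
      using P.mem_normal_if_pow_coprime_index[OF _ _ coprime] x subgroup.mem_carrier[OF SB] by blast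
  qed
  moreover have "S \<subseteq> F" using subgroup.subset[OF S(1)] by simp
  ultimately have "a \<otimes>\<^bsub>B\<^esub> b = a \<oplus>\<^bsub>B\<^esub> b" if "a \<in> S" "b \<in> S" for a b
    using that unfolding F_def by blast
  then have "sub_skew_brace S B" using SB by (intro sub_skew_braceI)
  then show ?thesis using S(2) by auto
qed

end
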